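(* Let $n\ge2$, $T=[a,b]\subset\mathbb{R}$, and consider the superior order ODE $$y^{(n)}(t)=f\big(t,y(t),y'(t),\dots,y^{(n-1)}(t)\big),$$ where $f$ is a given differentiable (smooth) function. With $x^1=y,\ x^2=y',\dots,x^n=y^{(n-1)}$ it is equivalent to the first order system $\frac{dx^i}{dt}=X_{(1)}^{(i)}(t,x)$, where $X_{(1)}^{(i)}(t,x)=x^{i+1}$ for $1\le i\le n-1$ and $X_{(1)}^{(n)}(t,x)=f(t,x^1,\dots,x^n)$. The geometrical objects on $J^1(T,\mathbb{R}^n)$ produced by the ODE (with respect to the pair of Euclidean metrics $\Delta=(1,\delta_{ij})$) are as follows. (i) The canonical non-linear connection is $\check\Gamma=\big(0,\check N_{(1)j}^{(i)}\big)$, where $\check N_{(1)j}^{(i)}$ ($i$ = row, $j$ = column) are the entries of the skew-symmetric matrix $$\check N_{(1)}=-\frac12\begin{pmatrix} 0&1&0&\cdots&0&0&-\frac{\partial f}{\partial x^1}\\ -1&0&1&\cdots&0&0&-\frac{\partial f}{\partial x^2}\\ 0&-1&0&\cdots&0&0&-\frac{\partial f}{\partial x^3}\\ \vdots&\vdots&\vdots&\ddots&\vdots&\vdots&\vdots\\ 0&0&0&\cdots&0&1&-\frac{\partial f}{\partial x^{n-2}}\\ 0&0&0&\cdots&-1&0&1-\frac{\partial f}{\partial x^{n-1}}\\ \frac{\partial f}{\partial x^1}&\frac{\partial f}{\partial x^2}&\frac{\partial f}{\partial x^3}&\cdots&\frac{\partial f}{\partial x^{n-2}}&-1+\frac{\partial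 f}{\partial x^{n-1}}&0 \end{pmatrix}.$$ (That is, the matrix $B$ with $\check N_{(1)}=-\frac12B$ is skew-symmetric, and above the diagonal $B_{i,i+1}=1$ for $1\le i\le n-2$, $B_{i,n}=-\frac{\partial f}{\partial x^i}$ for $1\le i\le n-2$, with these two contributions added when they would fall at the same position, $B_{n-1,n}=1-\frac{\partial f}{\partial x^{n-1}}$, and all other entries zero.) (ii) All adapted components of the canonical generalized Cartan connection $C\check\Gamma$ vanish. (iii) The effective adapted components of the torsion d-tensor of $C\check\Gamma$ are the entries of the matrices $\check R_{(1)1}=\big(\check R_{(1)1j}^{(i)}\big)_{i,j}$ (temporal torsion matrix) and $\check R_{(1)k}=\big(\check R_{(1)jk}^{(i)}\big)_{i,j}$, $k\in\{1,\dots,n\}$ (spatial torsion matrices), given by $$\check R_{(1)1}=\frac12\begin{pmatrix} 0&0&\cdots&0&-\frac{\partial^2f}{\partial t\partial x^1}\\ 0&0&\cdots&0&-\frac{\partial^2f}{\partial t\partial x^2}\\ \vdots&\vdots&\ddots&\vdots&\vdots\\ 0&0&\cdots&0&-\frac{\partial^2f}{\partial t\partial x^{n-1}}\\ \frac{\partial^2f}{\partial t\partial x^1}&\frac{\partial^2f}{\partial t\partial x^2}&\cdots&\frac{\partial^2f}{\partial t\partial x^{n-1}}&0 \end{pmatrix}$$ and $$\check R_{(1)k}=-\frac12\begin{pmatrix} 0&0&\cdots&0&-\frac{\partial^2f}{\partial x^k\partial x^1}\\ 0&0&\cdots&0&-\frac{\partial^2f}{\partial x^k\partial x^2}\\ \vdots&\vdots&\ddots&\vdots&\vdots\\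 0&0&\cdots&0&-\frac{\partial^2f}{\partial x^k\partial x^{n-1}}\\ \frac{\partial^2f}{\partial x^k\partial x^1}&\frac{\partial^2f}{\partial x^k\partial x^2}&\cdots&\frac{\partial^2f}{\partial x^k\partial x^{n-1}}&0 \end{pmatrix}.$$ (The temporal matrix $\check R_{(1)1}$ and the spatial matrix $\check R_{(1)k}$ with $k=1$ are different objects; there is only an overlap of notation.) (iv) All adapted components of the curvature d-tensor of $C\check\Gamma$ vanish. (v) The geometric electromagnetic distinguished 2-form is $\check F=\check F_{(i)j}^{(1)}\,\delta x_1^i\wedge dx^j$, where $\delta x_1^i=dx_1^i+\check N_{(1)k}^{(i)}dx^k$ for $i=1,\dots,n$, and $\check F^{(1)}=\big(\check F_{(i)j}^{(1)}\big)_{i,j=1,\dots,n}=-\check N_{(1)}$. (vi) The jet geometric Yang-Mills energy is $$EYM^{\text{SODE}}(t,x)=\frac14\Big[n-1-2\frac{\partial f}{\partial x^{n-1}}+\sum_{j=1}^{n-1}\Big(\frac{\partial f}{\partial x^j}\Big)^2\Big].$$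
   Context: Setting. $T=[a,b]\subset\mathbb{R}$ is a compact interval; $J^1(T,\mathbb{R}^n)\to T\times\mathbb{R}^n$, $n\ge2$, is the first order jet bundle with coordinates $(t,x^i,x_1^i)$, which transform by $\widetilde t=\widetilde t(t)$, $\widetilde x^i=\widetilde x^i(x^j)$, $\widetilde x_1^i=\frac{\partial\widetilde x^i}{\partial x^j}\frac{dt}{d\widetilde t}x_1^j$. Repeated indices are summed. All given functions are smooth. Everything is expressed in a fixed convenient chart, in which the metrics are the Euclidean ones, and $X=(X_{(1)}^{(i)})$ is assumed to behave as a d-tensor. Geometrical objects produced by a first order ODE system. Let $X=(X_{(1)}^{(i)}(t,x))$ be a d-tensor field giving the system $x_1^i=X_{(1)}^{(i)}(t,x(t))$, $x_1^i=dx^i/dt$, and let $\mathcal P=(h_{11}(t),\varphi_{ij}(x))$ be a pair of Riemannian metrics on $T$ and $\mathbb{R}^n$ with Christoffel symbols $H_{11}^1(t)$, $\gamma_{jk}^i(x)$; $h^{11}=1/h_{11}$; $r^l_{ijk}$ is the curvature tensor of $\varphi$. Put $X_{(1)||j}^{(i)}=\frac{\partial X_{(1)}^{(i)}}{\partial x^j}+X_{(1)}^{(m)}\gamma_{mj}^i$, $\;X_{(1)||j//1}^{(i)}=\frac{\partial X_{(1)||j}^{(i)}}{\partial t}-X_{(1)||j}^{(i)}H_{11}^1$, $\;X_{(1)||j||k}^{(i)}=\frac{\partial X_{(1)||j}^{(i)}}{\partial x^k}+X_{(1)||j}^{(m)}\gamma_{mk}^i-X_{(1)||m}^{(i)}\gamma_{jk}^m$.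 The objects produced by the system and $\mathcal P$ (arising from the least squares Lagrangian $h^{11}\varphi_{ij}[x_1^i-X_{(1)}^{(i)}][x_1^j-X_{(1)}^{(j)}]$) are given by the following formulas, which are to be taken as their definitions: - Canonical non-linear connection: $(M_{(1)1}^{(i)},N_{(1)j}^{(i)})$ with $M_{(1)1}^{(i)}=-H_{11}^1x_1^i$ and $N_{(1)j}^{(i)}=\gamma_{jk}^ix_1^k-\frac12\big[X_{(1)||j}^{(i)}-\varphi^{ir}X_{(1)||r}^{(s)}\varphi_{sj}\big]$. - Canonical generalized Cartan connection: adapted components $(H_{11}^1,0,\gamma_{jk}^i,0)$. - Torsion d-tensor: its effective (i.e. possibly nonzero; all others are identically zero) adapted components are $R_{(1)1j}^{(i)}=\frac12\big[X_{(1)||j//1}^{(i)}-\varphi^{ir}X_{(1)||r//1}^{(s)}\varphi_{sj}\big]$ (temporal) and $R_{(1)jk}^{(i)}=r_{jkm}^ix_1^m-\frac12\big[X_{(1)||j||k}^{(i)}-\varphi^{ir}X_{(1)||r||k}^{(s)}\varphi_{sj}\big]$ (spatial). - Curvature d-tensor: its only effective adapted components are $R_{ijk}^l=r_{ijk}^l$. - Electromagnetic distinguished 2-form: $F=F_{(i)j}^{(1)}\delta x_1^i\wedge dx^j$, $\;\delta x_1^i=dx_1^i+M_{(1)1}^{(i)}dt+N_{(1)k}^{(i)}dx^k$, $\;F_{(i)j}^{(1)}=\frac{h^{11}}2\big[\varphi_{im}X_{(1)||j}^{(m)}-\varphi_{jm}X_{(1)||i}^{(m)}\big]$. - Jet Yang-Mills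 energy: $EYM=\sum_{i=1}^{n-1}\sum_{j=i+1}^n\big[F_{(i)j}^{(1)}\big]^2$. "Produced by the system" (with no metrics mentioned) means: produced by the system and the Euclidean pair $\mathcal P=\Delta=(h_{11}=1,\varphi_{ij}=\delta_{ij})$. "Produced by the superior order ODE" means produced by its equivalent first order system. *)

theory Defs
  imports "HOL-Analysis.Analysis"
begin

section \<open>Coordinate indices\<close>

text \<open>The coordinates of \<open>\<real>^n\<close> are indexed by a finite linearly ordered type of cardinality \<open>n\<close>.
  \<open>pos i\<close> is the rank of \<open>i\<close> in \<open>{1..n}\<close>, and \<open>idx k\<close> is the index of rank \<open>k\<close>;
  \<open>idx\<close> is meaningful on \<open>{1..n}\<close> only.\<close>

definition pos :: "'n::{finite,linorder} \<Rightarrow> nat" where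
  "pos i = card {..i}"

definition idx :: "nat \<Rightarrow> 'n::{finite,linorder}" where
  "idx = inv pos"

lemma pos_strict_mono: "strict_mono (pos :: 'n::{finite,linorder} \<Rightarrow> nat)"
  unfolding strict_mono_def pos_def
  by (intro allI impI psubset_card_mono) auto

lemma bij_betw_pos: "bij_betw (pos :: 'n::{finite,linorder} \<Rightarrow> nat) UNIV {1..CARD('n)}"
proof -
  have inj: "inj (pos :: 'n \<Rightarrow> nat)"
    using pos_strict_mono by (rule strict_mono_imp_inj_on)
  have sub: "range (pos :: 'n \<Rightarrow> nat) \<subseteq> {1..CARD('n)}"
    by (auto simp: pos_def Suc_le_eq card_gt_0_iff intro!: card_mono)
  have "range (pos :: 'n \<Rightarrow> nat) = {1..CARD('n)}"
    by (rule card_subset_eq[OF _ sub]) (simp_all add: card_image[OF inj])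
  with inj show ?thesis
    by (simp add: bij_betw_def)
qed

section \<open>Derivatives and smoothness on \<open>T \<times> \<real>^n\<close>\<close>

text \<open>On a compact interval \<open>T\<close> the derivative in \<open>t\<close> is one-sided at the end points.\<close>

definition dwithin :: "real set \<Rightarrow> (real \<Rightarrow> real) \<Rightarrow> real \<Rightarrow> real" where
  "dwithin T y t = vector_derivative y (at t within T)"

text \<open>Partial derivative with respect to \<open>x\<^sup>k\<close>.\<close>

definition pd :: "'n::finite \<Rightarrow> (real^'n \<Rightarrow> real) \<Rightarrow> real^'n \<Rightarrow> real" where
  "pd k g x = deriv (\<lambda>s. g (x + s *\<^sub>R axis k 1)) 0"

primrec Ck_on :: "real set \<Rightarrow> nat \<Rightarrow> (real \<Rightarrow> real^'n::finite \<Rightarrow> real) \<Rightarrow> bool" where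
  "Ck_on T 0 F \<longleftrightarrow> continuous_on (T \<times> UNIV) (\<lambda>(t, x). F t x)"
| "Ck_on T (Suc m) F \<longleftrightarrow>
     continuous_on (T \<times> UNIV) (\<lambda>(t, x). F t x) \<and>
     (\<forall>t\<in>T. \<forall>x. (\<lambda>s. F s x) differentiable (at t within T)) \<and>
     (\<forall>t\<in>T. \<forall>x k. (\<lambda>s. F t (x + s *\<^sub>R axis k 1)) differentiable (at 0)) \<and>
     Ck_on T m (\<lambda>t x. dwithin T (\<lambda>s. F s x) t) \<and>
     (\<forall>k. Ck_on T m (\<lambda>t x. pd k (F t) x))"

definition smooth_on_strip :: "real set \<Rightarrow> (real \<Rightarrow> real^'n::finite \<Rightarrow> real) \<Rightarrow> bool" where
  "smooth_on_strip T F \<longleftrightarrow> (\<forall>m. Ck_on T m F)"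

section \<open>Pairs of metrics\<close>

record ('n::finite) metric_pair =
  h11 :: "real \<Rightarrow> real"
  phi :: "real^'n \<Rightarrow> real^'n^'n"

definition euclidean_pair :: "('n::finite) metric_pair" where
  "euclidean_pair = \<lparr>h11 = (\<lambda>_. 1), phi = (\<lambda>_. mat 1)\<rparr>"

definition h11_up :: "('n::finite) metric_pair \<Rightarrow> real \<Rightarrow> real" where
  "h11_up P t = 1 / h11 P t"

definition phi_up :: "('n::finite) metric_pair \<Rightarrow> real^'n \<Rightarrow> real^'n^'n" where
  "phi_up P x = matrix_inv (phi P x)"

definition Christoffel_H :: "real set \<Rightarrow> ('n::finite) metric_pair \<Rightarrow> real \<Rightarrow> real" where
  "Christoffel_H T P t = h11_up P t / 2 * dwithin T (h11 P) t"

text \<open>\<open>Christoffel P i j k\<close> is \<open>\<gamma>\<^sup>i\<^sub>j\<^sub>k\<close>.\<close>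

definition Christoffel ::
    "('n::finite) metric_pair \<Rightarrow> 'n \<Rightarrow> 'n \<Rightarrow> 'n \<Rightarrow> real^'n \<Rightarrow> real" where
  "Christoffel P i j k x =
     1/2 * (\<Sum>m\<in>UNIV. phi_up P x $ i $ m *
        (pd k (\<lambda>y. phi P y $ j $ m) x + pd j (\<lambda>y. phi P y $ m $ k) x - pd m (\<lambda>y. phi P y $ j $ k) x))"

text \<open>\<open>Riemann_curv P l i j k\<close> is \<open>r\<^sup>l\<^sub>i\<^sub>j\<^sub>k\<close>, with the last two lower indices as the
  antisymmetric pair.\<close>

definition Riemann_curv ::
    "('n::finite) metric_pair \<Rightarrow> 'n \<Rightarrow> 'n \<Rightarrow> 'n \<Rightarrow> 'n \<Rightarrow> real^'n \<Rightarrow> real" where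
  "Riemann_curv P l i j k x =
     pd k (Christoffel P l i j) x - pd j (Christoffel P l i k) x
     + (\<Sum>m\<in>UNIV. Christoffel P m i j x * Christoffel P l m k x
                 - Christoffel P m i k x * Christoffel P l m j x)"

section \<open>Covariant derivatives of a d-tensor \<open>X\<close>\<close>

type_synonym 'n dtensor = "'n \<Rightarrow> real \<Rightarrow> real^'n \<Rightarrow> real"

text \<open>\<open>X\<^sup>i\<^sub>|\<^sub>|\<^sub>j\<close>, then \<open>X\<^sup>i\<^sub>|\<^sub>|\<^sub>j\<^sub>/\<^sub>/\<^sub>1\<close> and \<open>X\<^sup>i\<^sub>|\<^sub>|\<^sub>j\<^sub>|\<^sub>|\<^sub>k\<close>.\<close>

definition cov_x ::
    "('n::finite) metric_pair \<Rightarrow> 'n dtensor \<Rightarrow> 'n \<Rightarrow> 'n \<Rightarrow> real \<Rightarrow> real^'n \<Rightarrow> real" where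
  "cov_x P X i j t x = pd j (X i t) x + (\<Sum>m\<in>UNIV. X m t x * Christoffel P i m j x)"

definition cov_xt ::
    "real set \<Rightarrow> ('n::finite) metric_pair \<Rightarrow> 'n dtensor \<Rightarrow> 'n \<Rightarrow> 'n \<Rightarrow> real \<Rightarrow> real^'n \<Rightarrow> real" where
  "cov_xt T P X i j t x =
     dwithin T (\<lambda>s. cov_x P X i j s x) t - cov_x P X i j t x * Christoffel_H T P t"

definition cov_xx ::
    "('n::finite) metric_pair \<Rightarrow> 'n dtensor \<Rightarrow> 'n \<Rightarrow> 'n \<Rightarrow> 'n \<Rightarrow> real \<Rightarrow> real^'n \<Rightarrow> real" where
  "cov_xx P X i j k t x =
     pd k (cov_x P X i j t) x
     + (\<Sum>m\<in>UNIV. cov_x P X m j t x * Christoffel P i m k x)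
     - (\<Sum>m\<in>UNIV. cov_x P X i m t x * Christoffel P m j k x)"

section \<open>Geometrical objects on \<open>J\<^sup>1(T, \<real>^n)\<close>\<close>

text \<open>Jet coordinates \<open>(t, x, v)\<close>, where \<open>v\<^sup>i\<close> stands for \<open>x\<^sub>1\<^sup>i\<close>; the same type serves for
  tangent vectors of the jet space in the fixed chart.\<close>

type_synonym 'n jet = "real \<times> (real^'n) \<times> (real^'n)"

definition nonlinear_M :: "real set \<Rightarrow> ('n::finite) metric_pair \<Rightarrow> 'n jet \<Rightarrow> 'n \<Rightarrow> real" where
  "nonlinear_M T P = (\<lambda>(t, x, v) i. - Christoffel_H T P t * v $ i)"

definition nonlinear_N ::
    "('n::finite) metric_pair \<Rightarrow> 'n dtensor \<Rightarrow> 'n jet \<Rightarrow> 'n \<Rightarrow> 'n \<Rightarrow> real" where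
  "nonlinear_N P X = (\<lambda>(t, x, v) i j.
     (\<Sum>k\<in>UNIV. Christoffel P i j k x * v $ k)
     - 1/2 * (cov_x P X i j t x
        - (\<Sum>r\<in>UNIV. \<Sum>s\<in>UNIV. phi_up P x $ i $ r * cov_x P X s r t x * phi P x $ s $ j)))"

text \<open>Adapted components of a connection of Cartan type: \<open>H\<^sup>1\<^sub>1\<^sub>1\<close>, \<open>G\<^sup>k\<^sub>j\<^sub>1\<close>, \<open>L\<^sup>i\<^sub>j\<^sub>k\<close> and
  \<open>C\<^sup>i\<^sup>(\<^sup>1\<^sup>)\<^sub>j\<^sub>(\<^sub>k\<^sub>)\<close>, each as a function of the jet point.\<close>

record ('n::finite) cartan_connection =
  conn_H :: "'n jet \<Rightarrow> real"
  conn_G :: "'n jet \<Rightarrow> 'n \<Rightarrow> 'n \<Rightarrow> real"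
  conn_L :: "'n jet \<Rightarrow> 'n \<Rightarrow> 'n \<Rightarrow> 'n \<Rightarrow> real"
  conn_C :: "'n jet \<Rightarrow> 'n \<Rightarrow> 'n \<Rightarrow> 'n \<Rightarrow> real"

definition cartan_canonical ::
    "real set \<Rightarrow> ('n::finite) metric_pair \<Rightarrow> 'n cartan_connection" where
  "cartan_canonical T P =
     \<lparr>conn_H = (\<lambda>(t, x, v). Christoffel_H T P t),
      conn_G = (\<lambda>_ k j. 0),
      conn_L = (\<lambda>(t, x, v) i j k. Christoffel P i j k x),
      conn_C = (\<lambda>_ i j k. 0)\<rparr>"

text \<open>Labels of the adapted frame \<open>\<delta>/\<delta>t\<close>, \<open>\<delta>/\<delta>x\<^sup>i\<close>, \<open>\<partial>/\<partial>x\<^sub>1\<^sup>i\<close>, and of the pairs of lower form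
  indices of a torsion or curvature component. These tensors are skew in
  their two vector arguments, so each pair of different blocks is listed in one order only.\<close>

datatype 'n adapted = Tm | Sp 'n | Vt 'n

datatype 'n form_slot =
  TmTm | TmSp 'n | SpSp 'n 'n | TmVt 'n | SpVt 'n 'n | VtVt 'n 'n

definition temporal_torsion ::
    "real set \<Rightarrow> ('n::finite) metric_pair \<Rightarrow> 'n dtensor \<Rightarrow> 'n jet \<Rightarrow> 'n \<Rightarrow> 'n \<Rightarrow> real" where
  "temporal_torsion T P X = (\<lambda>(t, x, v) i j.
     1/2 * (cov_xt T P X i j t x
        - (\<Sum>r\<in>UNIV. \<Sum>s\<in>UNIV. phi_up P x $ i $ r * cov_xt T P X s r t x * phi P x $ s $ j)))"

definition spatial_torsion ::
    "('n::finite) metric_pair \<Rightarrow> 'n dtensor \<Rightarrow> 'n jet \<Rightarrow> 'n \<Rightarrow> 'n \<Rightarrow> 'n \<Rightarrow> real" where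
  "spatial_torsion P X = (\<lambda>(t, x, v) i j k.
     (\<Sum>m\<in>UNIV. Riemann_curv P i j k m x * v $ m)
     - 1/2 * (cov_xx P X i j k t x
        - (\<Sum>r\<in>UNIV. \<Sum>s\<in>UNIV. phi_up P x $ i $ r * cov_xx P X s r k t x * phi P x $ s $ j)))"

text \<open>The torsion d-tensor: upper adapted index first, then the lower pair.\<close>

definition torsion ::
    "real set \<Rightarrow> ('n::finite) metric_pair \<Rightarrow> 'n dtensor \<Rightarrow> 'n jet \<Rightarrow> 'n adapted \<Rightarrow> 'n form_slot \<Rightarrow> real"
where
  "torsion T P X p A s = (case (A, s) of
      (Vt i, TmSp j) \<Rightarrow> temporal_torsion T P X p i j
    | (Vt i, SpSp j k) \<Rightarrow> spatial_torsion P X p i j k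
    | _ \<Rightarrow> 0)"

text \<open>The curvature d-tensor, \<open>curvature P p l i (SpSp j k) = R\<^sup>l\<^sub>i\<^sub>j\<^sub>k\<close>. A connection of Cartan type
  acts on the vertical block with the coefficients of the spatial one and is flat on the
  one-dimensional temporal block (\<open>H\<^sup>1\<^sub>1\<^sub>1\<close> depends on \<open>t\<close> only), so the endomorphism indices
  \<open>l\<close>, \<open>i\<close> range over the spatial block only.\<close>

definition curvature ::
    "('n::finite) metric_pair \<Rightarrow> 'n jet \<Rightarrow> 'n \<Rightarrow> 'n \<Rightarrow> 'n form_slot \<Rightarrow> real" where
  "curvature P = (\<lambda>(t, x, v) l i s. case s of
      SpSp j k \<Rightarrow> Riemann_curv P l i j k x
    | _ \<Rightarrow> 0)"

section \<open>Electromagnetic form and Yang-Mills energy\<close>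

definition cov_dt :: "('n::finite) jet \<Rightarrow> real" where
  "cov_dt w = fst w"

definition cov_dx :: "'n::finite \<Rightarrow> 'n jet \<Rightarrow> real" where
  "cov_dx i w = fst (snd w) $ i"

definition cov_dx1 :: "'n::finite \<Rightarrow> 'n jet \<Rightarrow> real" where
  "cov_dx1 i w = snd (snd w) $ i"

definition wedge :: "('v \<Rightarrow> real) \<Rightarrow> ('v \<Rightarrow> real) \<Rightarrow> 'v \<Rightarrow> 'v \<Rightarrow> real" where
  "wedge \<alpha> \<beta> u w = \<alpha> u * \<beta> w - \<alpha> w * \<beta> u"

definition delta_x1 ::
    "real set \<Rightarrow> ('n::finite) metric_pair \<Rightarrow> 'n dtensor \<Rightarrow> 'n jet \<Rightarrow> 'n \<Rightarrow> 'n jet \<Rightarrow> real" where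
  "delta_x1 T P X p i w =
     cov_dx1 i w + nonlinear_M T P p i * cov_dt w + (\<Sum>k\<in>UNIV. nonlinear_N P X p i k * cov_dx k w)"

definition em_comp ::
    "('n::finite) metric_pair \<Rightarrow> 'n dtensor \<Rightarrow> 'n \<Rightarrow> 'n \<Rightarrow> real \<Rightarrow> real^'n \<Rightarrow> real" where
  "em_comp P X i j t x =
     h11_up P t / 2 * ((\<Sum>m\<in>UNIV. phi P x $ i $ m * cov_x P X m j t x)
                     - (\<Sum>m\<in>UNIV. phi P x $ j $ m * cov_x P X m i t x))"

definition em_form ::
    "real set \<Rightarrow> ('n::finite) metric_pair \<Rightarrow> 'n dtensor \<Rightarrow> 'n jet \<Rightarrow> 'n jet \<Rightarrow> 'n jet \<Rightarrow> real" where
  "em_form T P X p u w = (case p of (t, x, v) \<Rightarrow>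
     \<Sum>i\<in>UNIV. \<Sum>j\<in>UNIV. em_comp P X i j t x * wedge (delta_x1 T P X p i) (cov_dx j) u w)"

definition yang_mills_energy ::
    "('n::{finite,linorder}) metric_pair \<Rightarrow> 'n dtensor \<Rightarrow> real \<Rightarrow> real^'n::{finite,linorder} \<Rightarrow> real" where
  "yang_mills_energy P X t x = (\<Sum>i\<in>UNIV. \<Sum>j\<in>{i<..}. (em_comp P X i j t x)\<^sup>2)"

section \<open>The superior order ODE and its first order system\<close>

text \<open>The curve \<open>(y, y', \<dots>, y\<^sup>(\<^sup>n\<^sup>-\<^sup>1\<^sup>))\<close>.\<close>

definition phase_curve ::
    "real set \<Rightarrow> (real \<Rightarrow> real) \<Rightarrow> real \<Rightarrow> real^'n::{finite,linorder}" where
  "phase_curve T y t = (\<chi> i. (dwithin T ^^ (pos i - 1)) y t)"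

definition solves_sode ::
    "real set \<Rightarrow> (real \<Rightarrow> real^'n::{finite,linorder} \<Rightarrow> real) \<Rightarrow> (real \<Rightarrow> real) \<Rightarrow> bool" where
  "solves_sode T f y \<longleftrightarrow>
     (\<forall>k<CARD('n). \<forall>t\<in>T. (dwithin T ^^ k) y differentiable (at t within T)) \<and>
     (\<forall>t\<in>T. (dwithin T ^^ CARD('n)) y t = f t (phase_curve T y t))"

definition solves_system ::
    "real set \<Rightarrow> ('n::finite) dtensor \<Rightarrow> (real \<Rightarrow> real^'n) \<Rightarrow> bool" where
  "solves_system T X c \<longleftrightarrow>
     (\<forall>t\<in>T. \<forall>i. ((\<lambda>s. c s $ i) has_real_derivative X i t (c t)) (at t within T))"

definition sode_field ::
    "(real \<Rightarrow> real^'n::{finite,linorder} \<Rightarrow> real) \<Rightarrow> 'n dtensor" where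
  "sode_field f i t x = (if pos i < CARD('n) then x $ idx (pos i + 1) else f t x)"

section \<open>The matrices of the theorem\<close>

text \<open>Entry \<open>(i, j)\<close>, \<open>1 \<le> i, j \<le> n\<close>, of the skew-symmetric matrix with superdiagonal \<open>1\<close> and last
  column \<open>-p\<^sub>i\<close> above the diagonal; the two contributions add up at \<open>(n-1, n)\<close>.\<close>

definition chain_upper :: "nat \<Rightarrow> (nat \<Rightarrow> real) \<Rightarrow> nat \<Rightarrow> nat \<Rightarrow> real" where
  "chain_upper n p i j = (if j = i + 1 then 1 else 0) + (if j = n then - p i else 0)"

definition chain_matrix :: "nat \<Rightarrow> (nat \<Rightarrow> real) \<Rightarrow> nat \<Rightarrow> nat \<Rightarrow> real" where
  "chain_matrix n p i j =
     (if i < j then chain_upper n p i j else if j < i then - chain_upper n p j i else 0)"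

text \<open>Entry \<open>(i, j)\<close> of the matrix that is zero except for the last column \<open>-q\<^sub>i\<close> and the last row
  \<open>q\<^sub>j\<close>, with \<open>0\<close> in the corner.\<close>

definition border_matrix :: "nat \<Rightarrow> (nat \<Rightarrow> real) \<Rightarrow> nat \<Rightarrow> nat \<Rightarrow> real" where
  "border_matrix n q i j =
     (if i < n \<and> j = n then - q i else if i = n \<and> j < n then q j else 0)"

definition index_matrix :: "(nat \<Rightarrow> nat \<Rightarrow> real) \<Rightarrow> real^'n::{finite,linorder}^'n::{finite,linorder}" where
  "index_matrix A = (\<chi> i j. A (pos i) (pos j))"

end

theory Submission
  imports Defs
begin

text \<open>
  For the Euclidean pair all Christoffel symbols vanish, so the covariant derivatives of \<open>X\<close> are
  plain partial derivatives and raising or lowering indices does nothing.  With \<open>J\<close> the Jacobian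
  matrix \<open>J\<^sub>i\<^sub>j = \<partial>X\<^sup>i/\<partial>x\<^sup>j\<close>, every object of the theorem is then read off the skew-symmetric part
  of \<open>J\<close>: the connection is \<open>-(J - J\<^sup>T)/2\<close> (\<open>nonlinear_N_euclidean\<close>), the electromagnetic
  components are its negative, and the torsion consists of the derivatives of \<open>\<plusminus>(J - J\<^sup>T)/2\<close> in
  \<open>t\<close> and in \<open>x\<^sup>k\<close>.

  For the field of the superior order ODE, the rows of \<open>J\<close> above the last are constant, with a
  single \<open>1\<close> on the superdiagonal, and the last row is the gradient of \<open>f\<close>
  (\<open>sode_jacobian\<close>).  Hence \<open>J - J\<^sup>T\<close> is the chain matrix.  Differentiating kills every row but
  the last, which leaves a border matrix (\<open>skew_part_of_last_row\<close>).  The energy is a quarter of the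
  sum of squares of the chain matrix above the diagonal, where row \<open>i < n - 1\<close>
  contributes \<open>1 + (\<partial>f/\<partial>x\<^sup>i)\<^sup>2\<close> and row \<open>n - 1\<close>, in which the two contributions meet,
  \<open>(1 - \<partial>f/\<partial>x\<^sup>n\<^sup>-\<^sup>1)\<^sup>2\<close> (\<open>sum_chain_upper_squares\<close>).

  The equivalence of the ODE with the system amounts to reading the first \<open>n - 1\<close> equations as
  the assertion that each component is the derivative of the preceding one
  (\<open>system_solution_is_phase_curve\<close>).
\<close>

section \<open>Ranks of coordinate indices\<close>

lemma pos_eq_iff [simp]: "pos i = pos j \<longleftrightarrow> i = j"
  for i j :: "'n::{finite,linorder}"
  using bij_betw_pos[where 'n='n] by (auto simp: bij_betw_def inj_on_eq_iff)

lemma idx_pos [simp]: "idx (pos i) = i"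
  for i :: "'n::{finite,linorder}"
  using bij_betw_pos[where 'n='n] by (simp add: idx_def bij_betw_def inv_f_f)

lemma pos_idx: "1 \<le> k \<Longrightarrow> k \<le> CARD('n) \<Longrightarrow> pos (idx k :: 'n::{finite,linorder}) = k"
  using bij_betw_pos[where 'n='n] unfolding idx_def bij_betw_def
  by (intro f_inv_into_f) auto

lemma pos_bounds: "1 \<le> pos i" "pos i \<le> CARD('n)"
  for i :: "'n::{finite,linorder}"
  using bij_betw_pos[where 'n='n] by (auto simp: bij_betw_def)

lemma pos_less_iff: "pos i < pos j \<longleftrightarrow> i < j"
  for i j :: "'n::{finite,linorder}"
  by (rule strict_mono_less[OF pos_strict_mono])

lemma sum_above_by_pos:
  fixes g :: "nat \<Rightarrow> nat \<Rightarrow> real"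
  shows "(\<Sum>i\<in>(UNIV :: 'n::{finite,linorder} set). \<Sum>j\<in>{i<..}. g (pos i) (pos j)) =
         (\<Sum>i=1..CARD('n). \<Sum>j\<in>{i<..CARD('n)}. g i j)"
proof -
  have above: "bij_betw pos {i<..} {pos i<..CARD('n)}" for i :: 'n
  proof (rule bij_betw_imageI)
    show "inj_on pos {i<..}"
      by (simp add: inj_on_def)
    show "pos ` {i<..} = {pos i<..CARD('n)}"
    proof
      show "pos ` {i<..} \<subseteq> {pos i<..CARD('n)}"
        by (auto simp: pos_less_iff pos_bounds)
      show "{pos i<..CARD('n)} \<subseteq> pos ` {i<..}"
      proof
        fix k assume "k \<in> {pos i<..CARD('n)}"
        then have "pos i < k" "pos (idx k :: 'n) = k"
          using pos_idx[where 'n='n, of k] by auto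
        then show "k \<in> pos ` {i<..}"
          by (metis greaterThan_iff image_eqI pos_less_iff)
      qed
    qed
  qed
  have "(\<Sum>i\<in>(UNIV :: 'n set). \<Sum>j\<in>{i<..}. g (pos i) (pos j)) =
        (\<Sum>i\<in>(UNIV :: 'n set). \<Sum>j\<in>{pos i<..CARD('n)}. g (pos i) j)"
    by (intro sum.cong refl sum.reindex_bij_betw[OF above])
  also have "\<dots> = (\<Sum>i=1..CARD('n). \<Sum>j\<in>{i<..CARD('n)}. g i j)"
    by (rule sum.reindex_bij_betw[OF bij_betw_pos])
  finally show ?thesis .
qed

section \<open>Derivatives in a chart\<close>

lemma pd_const [simp]: "pd k (\<lambda>_. c) x = 0"
  by (simp add: pd_def)

lemma pd_coordinate: "pd k (\<lambda>x. x $ i) x = (if i = k then 1 else 0)"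
proof -
  have "((\<lambda>s. (x + s *\<^sub>R axis k 1) $ i) has_field_derivative axis k 1 $ i) (at (0::real))"
    by (auto intro!: derivative_eq_intros)
  then have "pd k (\<lambda>x. x $ i) x = axis k 1 $ i"
    unfolding pd_def by (rule DERIV_imp_deriv)
  then show ?thesis
    by (simp add: axis_def)
qed

lemma dwithin_eqI:
  assumes "a < b" "t \<in> {a..b}" "(y has_real_derivative d) (at t within {a..b})"
  shows "dwithin {a..b} y t = d"
  using assms vector_derivative_within_closed_interval[of a b t y d]
  by (simp add: dwithin_def has_real_derivative_iff_has_vector_derivative)

lemma dwithin_const [simp]: "a < b \<Longrightarrow> t \<in> {a..b} \<Longrightarrow> dwithin {a..b} (\<lambda>_. c) t = 0"
  by (rule dwithin_eqI) auto

lemma has_real_derivative_iff_dwithin: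
  assumes "a < b" "t \<in> {a..b}"
  shows "(y has_real_derivative d) (at t within {a..b}) \<longleftrightarrow>
         y differentiable (at t within {a..b}) \<and> dwithin {a..b} y t = d"
proof
  assume *: "(y has_real_derivative d) (at t within {a..b})"
  then show "y differentiable (at t within {a..b}) \<and> dwithin {a..b} y t = d"
    using dwithin_eqI[OF assms *] real_differentiable_def by blast
next
  assume "y differentiable (at t within {a..b}) \<and> dwithin {a..b} y t = d"
  then show "(y has_real_derivative d) (at t within {a..b})"
    using dwithin_eqI[OF assms] by (metis real_differentiable_def)
qed

section \<open>The objects produced by a first order system and the Euclidean pair\<close>

lemma phi_euclidean [simp]: "phi euclidean_pair x = mat 1"
  by (simp add: euclidean_pair_def)

lemma h11_up_euclidean [simp]: "h11_up euclidean_pair t = 1"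
  by (simp add: euclidean_pair_def h11_up_def)

lemma phi_up_euclidean [simp]: "phi_up euclidean_pair x = mat 1"
  by (simp add: phi_up_def matrix_inv_def)

lemma Christoffel_H_euclidean [simp]:
  "a < b \<Longrightarrow> t \<in> {a..b} \<Longrightarrow> Christoffel_H {a..b} euclidean_pair t = 0"
  by (simp add: Christoffel_H_def euclidean_pair_def)

lemma Christoffel_euclidean [simp]: "Christoffel euclidean_pair i j k = (\<lambda>_. 0)"
  by (simp add: Christoffel_def fun_eq_iff)

lemma Riemann_curv_euclidean [simp]: "Riemann_curv euclidean_pair l i j k x = 0"
  by (simp add: Riemann_curv_def)

lemma cov_x_euclidean: "cov_x euclidean_pair X i j t = pd j (X i t)"
  by (simp add: cov_x_def fun_eq_iff)

lemma cov_xt_euclidean: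
  "a < b \<Longrightarrow> t \<in> {a..b} \<Longrightarrow>
   cov_xt {a..b} euclidean_pair X i j t x = dwithin {a..b} (\<lambda>s. pd j (X i s) x) t"
  by (simp add: cov_xt_def cov_x_euclidean)

lemma cov_xx_euclidean: "cov_xx euclidean_pair X i j k t x = pd k (pd j (X i t)) x"
  by (simp add: cov_xx_def cov_x_euclidean)

lemma sum_mat_1: "(\<Sum>r\<in>UNIV. mat 1 $ i $ r * g r) = (g i :: real)"
  for i :: "'n::finite"
  by (simp add: mat_def if_distrib[of "\<lambda>c. c * _"] cong: if_cong)

text \<open>The metric adjoint \<open>\<phi>\<^sup>i\<^sup>r A\<^sup>s\<^sub>r \<phi>\<^sub>s\<^sub>j\<close> of an endomorphism is its transpose in the
  Euclidean case.\<close>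

lemma sum_mat_1_adjoint:
  "(\<Sum>r\<in>UNIV. \<Sum>s\<in>UNIV. mat 1 $ i $ r * A s r * mat 1 $ s $ j) = (A j i :: real)"
  for i j :: "'n::finite"
proof -
  have "(\<Sum>s\<in>UNIV. mat 1 $ i $ r * A s r * mat 1 $ s $ j) = mat 1 $ i $ r * A j r" for r
    by (simp add: mat_def if_distrib[of "\<lambda>c. _ * c"] cong: if_cong)
  then show ?thesis
    by (simp add: sum_mat_1)
qed

lemma nonlinear_N_euclidean:
  "nonlinear_N euclidean_pair X (t, x, v) i j = - 1/2 * (pd j (X i t) x - pd i (X j t) x)"
  by (simp add: nonlinear_N_def sum_mat_1_adjoint cov_x_euclidean)

lemma temporal_torsion_euclidean:
  assumes "a < b" "t \<in> {a..b}"
  shows "temporal_torsion {a..b} euclidean_pair X (t, x, v) i j =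
    1/2 * (dwithin {a..b} (\<lambda>s. pd j (X i s) x) t - dwithin {a..b} (\<lambda>s. pd i (X j s) x) t)"
  using assms by (simp add: temporal_torsion_def sum_mat_1_adjoint cov_xt_euclidean)

lemma spatial_torsion_euclidean:
  "spatial_torsion euclidean_pair X (t, x, v) i j k =
    - 1/2 * (pd k (pd j (X i t)) x - pd k (pd i (X j t)) x)"
  by (simp add: spatial_torsion_def sum_mat_1_adjoint cov_xx_euclidean)

lemma em_comp_euclidean:
  "em_comp euclidean_pair X i j t x = 1/2 * (pd j (X i t) x - pd i (X j t) x)"
  by (simp add: em_comp_def sum_mat_1 cov_x_euclidean)

lemma curvature_euclidean: "curvature euclidean_pair p l i s = 0"
  by (cases p; cases s) (simp_all add: curvature_def)

lemma cartan_canonical_euclidean: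
  assumes "a < b" "t \<in> {a..b}"
  shows "conn_H (cartan_canonical {a..b} euclidean_pair) (t, x, v) = 0"
    and "conn_G (cartan_canonical {a..b} euclidean_pair) (t, x, v) k j = 0"
    and "conn_L (cartan_canonical {a..b} euclidean_pair) (t, x, v) i j k = 0"
    and "conn_C (cartan_canonical {a..b} euclidean_pair) (t, x, v) i j k = 0"
  using assms by (simp_all add: cartan_canonical_def)

lemma nonlinear_M_euclidean:
  "a < b \<Longrightarrow> t \<in> {a..b} \<Longrightarrow> nonlinear_M {a..b} euclidean_pair (t, x, v) i = 0"
  by (simp add: nonlinear_M_def)

lemma delta_x1_euclidean:
  assumes "a < b" "t \<in> {a..b}"
  shows "delta_x1 {a..b} euclidean_pair X (t, x, v) i =
    (\<lambda>z. cov_dx1 i z + (\<Sum>k\<in>UNIV. nonlinear_N euclidean_pair X (t, x, v) i k * cov_dx k z))"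
  using assms by (simp add: delta_x1_def nonlinear_M_euclidean fun_eq_iff)

lemma torsion_not_effective:
  "\<nexists>i j k. A = Vt i \<and> (s = TmSp j \<or> s = SpSp j k) \<Longrightarrow> torsion T P X p A s = 0"
  by (cases A; cases s) (auto simp: torsion_def)

section \<open>The Jacobian of the superior order field\<close>

lemma sode_jacobian:
  fixes f :: "real \<Rightarrow> real^'n::{finite,linorder} \<Rightarrow> real"
  shows "pd j (sode_field f i t) x =
    (if pos i < CARD('n) then if pos j = pos i + 1 then 1 else 0 else pd j (f t) x)"
proof (cases "pos i < CARD('n)")
  case True
  then have "pos (idx (pos i + 1) :: 'n) = pos i + 1"
    by (intro pos_idx) auto
  then have "(idx (pos i + 1) = j) \<longleftrightarrow> (pos j = pos i + 1)"
    by (metis idx_pos)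
  moreover have "sode_field f i t = (\<lambda>x. x $ idx (pos i + 1))"
    using True by (simp add: sode_field_def fun_eq_iff)
  ultimately show ?thesis
    using True by (simp add: pd_coordinate)
next
  case False
  then have "sode_field f i t = f t"
    by (simp add: sode_field_def fun_eq_iff)
  then show ?thesis
    using False by simp
qed

lemma sode_jacobian_skew_part:
  fixes f :: "real \<Rightarrow> real^'n::{finite,linorder} \<Rightarrow> real"
  shows "pd j (sode_field f i t) x - pd i (sode_field f j t) x =
    chain_matrix (CARD('n)) (\<lambda>k. pd (idx k) (f t) x) (pos i) (pos j)"
  using pos_bounds[of i] pos_bounds[of j] pos_eq_iff[of i j]
  by (auto simp: sode_jacobian chain_matrix_def chain_upper_def simp del: pos_eq_iff)

text \<open>Here \<open>A\<close> is a derivative of the Jacobian, which loses the constant rows.\<close>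

lemma skew_part_of_last_row:
  fixes A :: "'n::{finite,linorder} \<Rightarrow> 'n \<Rightarrow> real"
  assumes "\<And>i j. A i j = (if pos i < CARD('n) then 0 else q j)"
  shows "A i j - A j i = border_matrix (CARD('n)) (\<lambda>l. q (idx l)) (pos i) (pos j)"
  using pos_bounds[of i] pos_bounds[of j] pos_eq_iff[of i j]
  by (auto simp: assms border_matrix_def simp del: pos_eq_iff)

section \<open>The Yang-Mills energy\<close>

text \<open>The square of an entry above the diagonal is a sum of three delta functions in \<open>j\<close>; the
  cross term survives only at the position \<open>(n - 1, n)\<close>, where the two contributions meet.\<close>

lemma sum_chain_upper_squares:
  fixes p :: "nat \<Rightarrow> real"
  assumes "n \<ge> 2"
  shows "(\<Sum>i=1..n. \<Sum>j\<in>{i<..n}. (chain_upper n p i j)\<^sup>2) =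
    real n - 1 - 2 * p (n - 1) + (\<Sum>j=1..n-1. (p j)\<^sup>2)"
proof -
  have row: "(\<Sum>j\<in>{i<..n}. (chain_upper n p i j)\<^sup>2) =
      1 + (p i)\<^sup>2 - (if i = n - 1 then 2 * p i else 0)" if "i \<in> {1..n-1}" for i
  proof -
    have "(chain_upper n p i j)\<^sup>2 = (if j = i + 1 then 1 else 0) + (if j = n then (p i)\<^sup>2 else 0)
        - (if j = n then if i = n - 1 then 2 * p i else 0 else 0)" for j
      using that assms by (auto simp: chain_upper_def power2_eq_square algebra_simps)
    then have "(\<Sum>j\<in>{i<..n}. (chain_upper n p i j)\<^sup>2) =
        (\<Sum>j\<in>{i<..n}. if j = i + 1 then 1 else 0) + (\<Sum>j\<in>{i<..n}. if j = n then (p i)\<^sup>2 else 0)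
        - (\<Sum>j\<in>{i<..n}. if j = n then if i = n - 1 then 2 * p i else 0 else 0)"
      by (simp only: sum.distrib sum_subtractf)
    moreover have "i + 1 \<in> {i<..n}" "n \<in> {i<..n}"
      using that by auto
    ultimately show ?thesis
      by (simp only: sum.delta finite_greaterThanAtMost if_True)
  qed
  have "{1..n} = insert n {1..n-1}"
    using assms by auto
  then have "(\<Sum>i=1..n. \<Sum>j\<in>{i<..n}. (chain_upper n p i j)\<^sup>2) =
      (\<Sum>i=1..n-1. \<Sum>j\<in>{i<..n}. (chain_upper n p i j)\<^sup>2)"
    using assms by simp
  also have "\<dots> = (\<Sum>i=1..n-1. 1 + (p i)\<^sup>2 - (if i = n - 1 then 2 * p i else 0))"
    by (rule sum.cong[OF refl row])
  also have "\<dots> = real (n - 1) + (\<Sum>i=1..n-1. (p i)\<^sup>2) - 2 * p (n - 1)"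
    using assms by (simp add: sum.distrib sum_subtractf)
  finally show ?thesis
    using assms by (simp add: of_nat_diff)
qed

lemma yang_mills_energy_sode:
  fixes f :: "real \<Rightarrow> real^'n::{finite,linorder} \<Rightarrow> real"
  assumes "CARD('n) \<ge> 2"
  shows "yang_mills_energy euclidean_pair (sode_field f) t x =
    1/4 * (real (CARD('n)) - 1 - 2 * pd (idx (CARD('n) - 1)) (f t) x
      + (\<Sum>j=1..CARD('n)-1. (pd (idx j) (f t) x)\<^sup>2))"
proof -
  define p where "p k = pd (idx k) (f t) x" for k
  have "(em_comp euclidean_pair (sode_field f) i j t x)\<^sup>2
      = 1/4 * (chain_upper (CARD('n)) p (pos i) (pos j))\<^sup>2" if "j \<in> {i<..}" for i j :: 'n
    using that
    by (simp add: em_comp_euclidean sode_jacobian_skew_part chain_matrix_def pos_less_iff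
        power_divide p_def[abs_def])
  then have "yang_mills_energy euclidean_pair (sode_field f) t x
      = (\<Sum>i\<in>(UNIV :: 'n set). \<Sum>j\<in>{i<..}. 1/4 * (chain_upper (CARD('n)) p (pos i) (pos j))\<^sup>2)"
    unfolding yang_mills_energy_def by (intro sum.cong refl)
  also have "\<dots> = 1/4 * (\<Sum>i=1..CARD('n). \<Sum>j\<in>{i<..CARD('n)}. (chain_upper (CARD('n)) p i j)\<^sup>2)"
    by (subst sum_above_by_pos[where g="\<lambda>i j. 1/4 * (chain_upper (CARD('n)) p i j)\<^sup>2"])
      (simp add: sum_distrib_left)
  finally show ?thesis
    by (simp only: sum_chain_upper_squares[OF assms] p_def)
qed

section \<open>Equivalence of the ODE with its first order system\<close>

lemma sode_field_phase_curve:
  fixes f :: "real \<Rightarrow> real^'n::{finite,linorder} \<Rightarrow> real"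
  shows "sode_field f i t (phase_curve T y t) =
    (if pos i < CARD('n) then (dwithin T ^^ pos i) y t else f t (phase_curve T y t))"
  using pos_idx[where 'n='n, of "pos i + 1"] by (auto simp: sode_field_def phase_curve_def)

text \<open>The equation of rank \<open>k < n\<close> for the phase curve says that the \<open>(k - 1)\<close>-th derivative of \<open>y\<close>
  is differentiable with derivative \<open>y\<^sup>(\<^sup>k\<^sup>)\<close>, and the value is automatic; only the equation of
  rank \<open>n\<close> adds more than differentiability, namely the ODE.\<close>

lemma solves_sode_iff_phase_curve:
  fixes f :: "real \<Rightarrow> real^'n::{finite,linorder} \<Rightarrow> real"
  assumes "a < b"
  shows "solves_sode {a..b} f y \<longleftrightarrow> solves_system {a..b} (sode_field f) (phase_curve {a..b} y)"
proof -
  let ?T = "{a..b}" and ?n = "CARD('n)"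
  let ?D = "\<lambda>k. (dwithin ?T ^^ k) y" and ?c = "phase_curve ?T y :: real \<Rightarrow> real^'n::{finite,linorder}"
  have component: "((\<lambda>s. ?c s $ i) has_real_derivative sode_field f i t (?c t)) (at t within ?T) \<longleftrightarrow>
      ?D (pos i - 1) differentiable (at t within ?T) \<and>
      (pos i = ?n \<longrightarrow> ?D ?n t = f t (?c t))" if "t \<in> ?T" for t and i :: 'n
  proof -
    have "?D (pos i) = dwithin ?T (?D (pos i - 1))"
      using pos_bounds(1)[of i] by (cases "pos i") auto
    moreover have "(\<lambda>s. ?c s $ i) = ?D (pos i - 1)"
      by (simp add: phase_curve_def fun_eq_iff)
    ultimately show ?thesis
      using pos_bounds(2)[of i]
      by (auto simp: has_real_derivative_iff_dwithin[OF assms that] sode_field_phase_curve)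
  qed
  have ranks: "(\<forall>i::'n. Q (pos i - 1)) \<longleftrightarrow> (\<forall>k<?n. Q k)" for Q
  proof
    assume *: "\<forall>i::'n. Q (pos i - 1)"
    show "\<forall>k<?n. Q k"
    proof (intro allI impI)
      fix k assume "k < ?n"
      then show "Q k"
        using *[rule_format, of "idx (k + 1)"] pos_idx[where 'n='n, of "k + 1"] by simp
    qed
  next
    assume *: "\<forall>k<?n. Q k"
    show "\<forall>i::'n. Q (pos i - 1)"
    proof
      fix i :: 'n
      show "Q (pos i - 1)"
        using * pos_bounds[of i] by simp
    qed
  qed
  have last: "(\<forall>i::'n. pos i = ?n \<longrightarrow> R) \<longleftrightarrow> R" for R
    using pos_idx[where 'n='n, of ?n] by (auto simp: Suc_le_eq)
  have "solves_system ?T (sode_field f) ?c \<longleftrightarrow>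
      (\<forall>t\<in>?T. (\<forall>i::'n. ?D (pos i - 1) differentiable (at t within ?T)) \<and>
        (\<forall>i::'n. pos i = ?n \<longrightarrow> ?D ?n t = f t (?c t)))"
    unfolding solves_system_def by (intro ball_cong refl) (simp only: component all_conj_distrib)
  also have "\<dots> \<longleftrightarrow> (\<forall>t\<in>?T. (\<forall>k<?n. ?D k differentiable (at t within ?T)) \<and> ?D ?n t = f t (?c t))"
  proof (intro ball_cong refl)
    fix t
    show "((\<forall>i::'n. ?D (pos i - 1) differentiable (at t within ?T)) \<and>
          (\<forall>i::'n. pos i = ?n \<longrightarrow> ?D ?n t = f t (?c t))) \<longleftrightarrow>
        (\<forall>k<?n. ?D k differentiable (at t within ?T)) \<and> ?D ?n t = f t (?c t)"
      by (simp only: ranks[of "\<lambda>k. ?D k differentiable (at t within ?T)"] last)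
  qed
  also have "\<dots> \<longleftrightarrow> solves_sode ?T f y"
    unfolding solves_sode_def by blast
  finally show ?thesis
    by simp
qed

text \<open>By induction on the rank, the component of rank \<open>k + 1\<close> is the \<open>k\<close>-th derivative of the
  first one.  Both curves are only compared on \<open>T\<close>, so each iterated derivative has to be seen to
  depend on the values on \<open>T\<close> alone.\<close>

lemma system_solution_is_phase_curve:
  fixes f :: "real \<Rightarrow> real^'n::{finite,linorder} \<Rightarrow> real"
  assumes "a < b" and sol: "solves_system {a..b} (sode_field f) c" and "t \<in> {a..b}"
  shows "c t = phase_curve {a..b} (\<lambda>s. c s $ idx 1) t"
proof -
  let ?D = "\<lambda>k. (dwithin {a..b} ^^ k) (\<lambda>s. c s $ idx 1)"
  have D: "\<forall>t\<in>{a..b}. ?D k t = c t $ idx (k + 1)" if "k < CARD('n)" for k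
    using that
  proof (induction k)
    case 0
    show ?case by simp
  next
    case (Suc k)
    show ?case
    proof
      fix t assume t: "t \<in> {a..b}"
      have "((\<lambda>s. c s $ idx (k + 1)) has_real_derivative c t $ idx (k + 2)) (at t within {a..b})"
        using sol[unfolded solves_system_def, rule_format, OF t, of "idx (k + 1)"]
          pos_idx[where 'n='n, of "k + 1"] Suc.prems
        by (simp add: sode_field_def)
      then have "(?D k has_real_derivative c t $ idx (k + 2)) (at t within {a..b})"
        by (rule has_field_derivative_transform_within[OF _ zero_less_one t])
          (use Suc in auto)
      then show "?D (Suc k) t = c t $ idx (Suc k + 1)"
        using dwithin_eqI[OF assms(1) t] by simp
    qed
  qed
  show ?thesis
  proof (rule vec_eq_iff[THEN iffD2], rule allI)
    fix i :: 'n
    show "c t $ i = phase_curve {a..b} (\<lambda>s. c s $ idx 1) t $ i"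
      using D[of "pos i - 1"] pos_bounds[of i] assms(3) by (simp add: phase_curve_def)
  qed
qed

lemma solves_system_cong:
  assumes "solves_system T X c" and "\<And>t. t \<in> T \<Longrightarrow> c t = d t"
  shows "solves_system T X d"
  unfolding solves_system_def
proof (intro ballI allI)
  fix t i assume t: "t \<in> T"
  then have "((\<lambda>s. c s $ i) has_real_derivative X i t (d t)) (at t within T)"
    using assms by (auto simp: solves_system_def)
  then show "((\<lambda>s. d s $ i) has_real_derivative X i t (d t)) (at t within T)"
    by (rule has_field_derivative_transform_within[OF _ zero_less_one t]) (simp add: assms(2))
qed

section \<open>The geometry of the superior order ODE\<close>

theorem theorem4p3:
  fixes a b :: real
    and T :: "real set"
    and n :: nat
    and f :: "real \<Rightarrow> real^'n::{finite,linorder} \<Rightarrow> real"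
    and X :: "'n dtensor"
    and \<Delta> :: "'n metric_pair"
    and N :: "'n jet \<Rightarrow> real^'n::{finite,linorder}^'n::{finite,linorder}"
  assumes "a < b" and "T = {a..b}"
    and "n = CARD('n)" and "n \<ge> 2"
    and "smooth_on_strip T f"
    and "X = sode_field f"
    and "\<Delta> = euclidean_pair"
    and "N = (\<lambda>p. \<chi> i j. nonlinear_N \<Delta> X p i j)"
  shows
    \<comment> \<open>equivalence of the ODE with the first order system\<close>
    "(\<forall>y. solves_sode T f y \<longleftrightarrow> solves_system T X (phase_curve T y)) \<and>
     (\<forall>c. solves_system T X c \<longrightarrow>
        solves_sode T f (\<lambda>s. c s $ idx 1) \<and>
        (\<forall>t\<in>T. c t = phase_curve T (\<lambda>s. c s $ idx 1) t)) \<and>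
     (\<forall>t\<in>T. \<forall>x v.
       \<comment> \<open>(i) canonical non-linear connection\<close>
       (\<forall>i. nonlinear_M T \<Delta> (t, x, v) i = 0) \<and>
       N (t, x, v) = (- 1/2) *\<^sub>R index_matrix (chain_matrix n (\<lambda>k. pd (idx k) (f t) x)) \<and>
       transpose (N (t, x, v)) = - N (t, x, v) \<and>
       \<comment> \<open>(ii) Cartan connection\<close>
       conn_H (cartan_canonical T \<Delta>) (t, x, v) = 0 \<and>
       (\<forall>k j. conn_G (cartan_canonical T \<Delta>) (t, x, v) k j = 0) \<and>
       (\<forall>i j k. conn_L (cartan_canonical T \<Delta>) (t, x, v) i j k = 0) \<and>
       (\<forall>i j k. conn_C (cartan_canonical T \<Delta>) (t, x, v) i j k = 0) \<and>
       \<comment> \<open>(iii) torsion\<close>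
       (\<chi> i j. torsion T \<Delta> X (t, x, v) (Vt i) (TmSp j)) =
         (1/2) *\<^sub>R index_matrix (border_matrix n (\<lambda>l. dwithin T (\<lambda>s. pd (idx l) (f s) x) t)) \<and>
       (\<forall>k. (\<chi> i j. torsion T \<Delta> X (t, x, v) (Vt i) (SpSp j k)) =
         (- 1/2) *\<^sub>R index_matrix (border_matrix n (\<lambda>l. pd k (pd (idx l) (f t)) x))) \<and>
       (\<forall>A s. (\<nexists>i j k. A = Vt i \<and> (s = TmSp j \<or> s = SpSp j k)) \<longrightarrow>
         torsion T \<Delta> X (t, x, v) A s = 0) \<and>
       \<comment> \<open>(iv) curvature\<close>
       (\<forall>l i s. curvature \<Delta> (t, x, v) l i s = 0) \<and>
       \<comment> \<open>(v) electromagnetic 2-form\<close>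
       (\<forall>i z. delta_x1 T \<Delta> X (t, x, v) i z =
          cov_dx1 i z + (\<Sum>k\<in>UNIV. N (t, x, v) $ i $ k * cov_dx k z)) \<and>
       (\<forall>u w. em_form T \<Delta> X (t, x, v) u w =
          (\<Sum>i\<in>UNIV. \<Sum>j\<in>UNIV. em_comp \<Delta> X i j t x *
             wedge (\<lambda>z. cov_dx1 i z + (\<Sum>k\<in>UNIV. N (t, x, v) $ i $ k * cov_dx k z)) (cov_dx j) u w)) \<and>
       (\<chi> i j. em_comp \<Delta> X i j t x) = - N (t, x, v) \<and>
       \<comment> \<open>(vi) Yang-Mills energy\<close>
       yang_mills_energy \<Delta> X t x =
         1/4 * (real n - 1 - 2 * pd (idx (n - 1)) (f t) x
                + (\<Sum>j=1..n-1. (pd (idx j) (f t) x)\<^sup>2)))"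
proof -
  note T = assms(2) and n = assms(3) and X = assms(6) and \<Delta> = assms(7) and N = assms(8)
  have system: "solves_sode T f (\<lambda>s. c s $ idx 1) \<and>
      (\<forall>t\<in>T. c t = phase_curve T (\<lambda>s. c s $ idx 1) t)" if "solves_system T X c" for c
    using that system_solution_is_phase_curve[OF assms(1)] solves_system_cong
      solves_sode_iff_phase_curve[OF assms(1)]
    unfolding T X by blast
  have flat: "nonlinear_M T \<Delta> (t, x, v) i = 0" "curvature \<Delta> (t, x, v) i j s = 0"
    "conn_H (cartan_canonical T \<Delta>) (t, x, v) = 0" "conn_G (cartan_canonical T \<Delta>) (t, x, v) i j = 0"
    "conn_L (cartan_canonical T \<Delta>) (t, x, v) i j k = 0" "conn_C (cartan_canonical T \<Delta>) (t, x, v) i j k = 0"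
    if "t \<in> T" for t x v i j k s
    using that assms(1)
    by (simp_all add: T \<Delta> nonlinear_M_euclidean curvature_euclidean cartan_canonical_euclidean)
  have N_entry: "N (t, x, v) $ i $ k = nonlinear_N \<Delta> X (t, x, v) i k" for t x v i k
    by (simp add: N)
  have N_chain: "N (t, x, v) =
      (- 1/2) *\<^sub>R index_matrix (chain_matrix n (\<lambda>k. pd (idx k) (f t) x))" for t x v
    by (simp add: vec_eq_iff N_entry \<Delta> X n nonlinear_N_euclidean sode_jacobian_skew_part
        index_matrix_def)
  have N_skew: "transpose (N p) = - N p" for p
    by (cases p) (simp add: vec_eq_iff transpose_def N_entry \<Delta> nonlinear_N_euclidean field_simps)
  have em: "(\<chi> i j. em_comp \<Delta> X i j t x) = - N (t, x, v)" for t x v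
    by (simp add: vec_eq_iff N_entry \<Delta> nonlinear_N_euclidean em_comp_euclidean)
  have delta: "delta_x1 T \<Delta> X (t, x, v) i =
      (\<lambda>z. cov_dx1 i z + (\<Sum>k\<in>UNIV. N (t, x, v) $ i $ k * cov_dx k z))" if "t \<in> T" for t x v i
    using that assms(1) by (simp add: N_entry \<Delta> T delta_x1_euclidean)
  have temporal: "(\<chi> i j. torsion T \<Delta> X (t, x, v) (Vt i) (TmSp j)) =
      (1/2) *\<^sub>R index_matrix (border_matrix n (\<lambda>l. dwithin T (\<lambda>s. pd (idx l) (f s) x) t))"
    if t: "t \<in> T" for t x v
  proof -
    have "dwithin T (\<lambda>s. pd j (X i s) x) t - dwithin T (\<lambda>s. pd i (X j s) x) t =
        border_matrix n (\<lambda>l. dwithin T (\<lambda>s. pd (idx l) (f s) x) t) (pos i) (pos j)" for i j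
      unfolding n
    proof (rule skew_part_of_last_row[where A="\<lambda>i j. dwithin T (\<lambda>s. pd j (X i s) x) t"
          and q="\<lambda>j. dwithin T (\<lambda>s. pd j (f s) x) t"])
      show "dwithin T (\<lambda>s. pd j (X i s) x) t =
          (if pos i < CARD('n) then 0 else dwithin T (\<lambda>s. pd j (f s) x) t)" for i j
        using t assms(1) by (auto simp: X T sode_jacobian)
    qed
    then show ?thesis
      using t assms(1)
      by (simp add: vec_eq_iff torsion_def temporal_torsion_euclidean index_matrix_def \<Delta> T)
  qed
  have spatial: "(\<chi> i j. torsion T \<Delta> X (t, x, v) (Vt i) (SpSp j k)) =
      (- 1/2) *\<^sub>R index_matrix (border_matrix n (\<lambda>l. pd k (pd (idx l) (f t)) x))" for t x v k
  proof -
    have "pd j (X i t) = (if pos i < CARD('n) then (\<lambda>_. if pos j = pos i + 1 then 1 else 0)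
        else pd j (f t))" for i j
      by (simp add: X sode_jacobian fun_eq_iff)
    then have "pd k (pd j (X i t)) x - pd k (pd i (X j t)) x =
        border_matrix n (\<lambda>l. pd k (pd (idx l) (f t)) x) (pos i) (pos j)" for i j
      unfolding n
      by (intro skew_part_of_last_row[where A="\<lambda>i j. pd k (pd j (X i t)) x"
            and q="\<lambda>j. pd k (pd j (f t)) x"]) simp
    then show ?thesis
      by (simp add: vec_eq_iff torsion_def spatial_torsion_euclidean index_matrix_def \<Delta>)
  qed
  have energy: "yang_mills_energy \<Delta> X t x =
      1/4 * (real n - 1 - 2 * pd (idx (n - 1)) (f t) x + (\<Sum>j=1..n-1. (pd (idx j) (f t) x)\<^sup>2))" for t x
    using assms(4) unfolding \<Delta> X n by (rule yang_mills_energy_sode)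
  show ?thesis
  proof (intro conjI ballI allI impI)
    show "solves_sode T f y \<longleftrightarrow> solves_system T X (phase_curve T y)" for y
      unfolding T X by (rule solves_sode_iff_phase_curve[OF assms(1)])
  next
    fix t x v assume t: "t \<in> T"
    show "em_form T \<Delta> X (t, x, v) u w =
        (\<Sum>i\<in>UNIV. \<Sum>j\<in>UNIV. em_comp \<Delta> X i j t x *
          wedge (\<lambda>z. cov_dx1 i z + (\<Sum>k\<in>UNIV. N (t, x, v) $ i $ k * cov_dx k z)) (cov_dx j) u w)"
      for u w
      by (simp add: em_form_def delta[OF t])
  next
    fix t x v and A :: "'n adapted" and s :: "'n form_slot"
    assume "\<nexists>i j k. A = Vt i \<and> (s = TmSp j \<or> s = SpSp j k)"
    then show "torsion T \<Delta> X (t, x, v) A s = 0"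
      by (rule torsion_not_effective)
  next
    fix c assume "solves_system T X c"
    then show "solves_sode T f (\<lambda>s. c s $ idx 1)"
      by (rule system[THEN conjunct1])
  next
    fix c t assume "solves_system T X c" "t \<in> T"
    then show "c t = phase_curve T (\<lambda>s. c s $ idx 1) t"
      using system by blast
  qed (simp_all only: N_skew flat em delta temporal spatial energy, rule N_chain)
qed

end
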